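(* Let $\mathcal{A}$ be a connected cochain DG algebra over a field $k$ and let $G$ be a finite subgroup of $\mathrm{Aut}_{dg}(\mathcal{A})$. Then: (1) $\mathcal{A}^G=\{a\in\mathcal{A}\mid g(a)=a\ \forall g\in G\}$ is a connected cochain DG subalgebra of $\mathcal{A}$; (2) $H(G)=\{H(g)\mid g\in G\}$ is a finite subgroup of $\mathrm{Aut}_{gr}H(\mathcal{A})$; (3) the graded fixed subalgebra $H(\mathcal{A})^{H(G)}$ of $H(\mathcal{A})$ is isomorphic to $H(\mathcal{A}^G)$.
   Context: $k$ is the base field. A connected cochain DG algebra is a DG $k$-algebra $\mathcal{A}=\bigoplus_{i\ge 0}\mathcal{A}^i$ with $\mathcal{A}^0=k$ and differential of degree $+1$. $\mathrm{Aut}_{dg}(\mathcal{A})$ is the group of DG algebra automorphisms of $\mathcal{A}$, $H(\mathcal{A})$ the cohomology graded algebra, $H(g)$ the automorphism of $H(\mathcal{A})$ induced by $g$, and $\mathrm{Aut}_{gr}H(\mathcal{A})$ the group of graded algebra automorphisms of $H(\mathcal{A})$.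
   Formalization: Part (3) is proved under the added assumption that the order of G is nonzero in k (char k does not divide |G|); without it (3) is false, e.g. in characteristic 2 with dx = dy = w, zero products in positive degree, and G swapping x and y. *)

theory Defs
  imports "HOL-Algebra.Module" "HOL-Algebra.QuotRing" "HOL-Algebra.Subrings" "HOL-Algebra.Bij"
begin

section \<open>Graded algebras and cochain DG algebras\<close>

record ('a, 'b) graded_algebra = "('a, 'b) module" +
  component :: "nat \<Rightarrow> 'b set"

record ('a, 'b) dg_algebra = "('a, 'b) graded_algebra" +
  differential :: "'b \<Rightarrow> 'b"

definition homogeneous_decomposition ::
    "('a, 'b, 'm) graded_algebra_scheme \<Rightarrow> (nat \<Rightarrow> 'b) \<Rightarrow> 'b \<Rightarrow> bool"
  where "homogeneous_decomposition A f x \<longleftrightarrow>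
    (\<forall>i. f i \<in> component A i) \<and> finite {i. f i \<noteq> \<zero>\<^bsub>A\<^esub>} \<and>
    x = (\<Oplus>\<^bsub>A\<^esub>i \<in> {i. f i \<noteq> \<zero>\<^bsub>A\<^esub>}. f i)"

text \<open>The library locale \<open>algebra\<close> requires commutativity, so the compatibility of the
  scalar action with the (noncommutative) product is stated here. The axiom
  \<open>direct_sum\<close> says that the algebra is the internal direct sum of its components.\<close>

locale graded_algebra = K?: field K + A?: ring A + module K A
  for K :: "('a, 'c) ring_scheme" (structure)
    and A :: "('a, 'b, 'm) graded_algebra_scheme" (structure) +
  assumes smult_mult_left:
      "\<lbrakk>c \<in> carrier K; x \<in> carrier A; y \<in> carrier A\<rbrakk> \<Longrightarrow>
        (c \<odot>\<^bsub>A\<^esub> x) \<otimes>\<^bsub>A\<^esub> y = c \<odot>\<^bsub>A\<^esub> (x \<otimes>\<^bsub>A\<^esub> y)"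
    and smult_mult_right:
      "\<lbrakk>c \<in> carrier K; x \<in> carrier A; y \<in> carrier A\<rbrakk> \<Longrightarrow>
        x \<otimes>\<^bsub>A\<^esub> (c \<odot>\<^bsub>A\<^esub> y) = c \<odot>\<^bsub>A\<^esub> (x \<otimes>\<^bsub>A\<^esub> y)"
    and component_submodule: "submodule (component A i) K A"
    and direct_sum: "x \<in> carrier A \<Longrightarrow> \<exists>!f. homogeneous_decomposition A f x"
    and one_component: "\<one>\<^bsub>A\<^esub> \<in> component A 0"
    and mult_component:
      "\<lbrakk>x \<in> component A i; y \<in> component A j\<rbrakk> \<Longrightarrow> x \<otimes>\<^bsub>A\<^esub> y \<in> component A (i + j)"

locale cochain_dg_algebra = graded_algebra K A
  for K :: "('a, 'c) ring_scheme" (structure)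
    and A :: "('a, 'b, 'm) dg_algebra_scheme" (structure) +
  assumes differential_closed: "x \<in> carrier A \<Longrightarrow> differential A x \<in> carrier A"
    and differential_add:
      "\<lbrakk>x \<in> carrier A; y \<in> carrier A\<rbrakk> \<Longrightarrow>
        differential A (x \<oplus>\<^bsub>A\<^esub> y) = differential A x \<oplus>\<^bsub>A\<^esub> differential A y"
    and differential_smult:
      "\<lbrakk>c \<in> carrier K; x \<in> carrier A\<rbrakk> \<Longrightarrow>
        differential A (c \<odot>\<^bsub>A\<^esub> x) = c \<odot>\<^bsub>A\<^esub> differential A x"
    and differential_degree:
      "x \<in> component A i \<Longrightarrow> differential A x \<in> component A (Suc i)"
    and differential_squared:
      "x \<in> carrier A \<Longrightarrow> differential A (differential A x) = \<zero>\<^bsub>A\<^esub>"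
    and leibniz:
      "\<lbrakk>x \<in> component A i; y \<in> carrier A\<rbrakk> \<Longrightarrow>
        differential A (x \<otimes>\<^bsub>A\<^esub> y) =
          (differential A x \<otimes>\<^bsub>A\<^esub> y) \<oplus>\<^bsub>A\<^esub>
          ((\<ominus>\<^bsub>A\<^esub> \<one>\<^bsub>A\<^esub>) [^]\<^bsub>A\<^esub> i) \<otimes>\<^bsub>A\<^esub> (x \<otimes>\<^bsub>A\<^esub> differential A y)"

text \<open>Connectedness means that the unit map from \<open>K\<close> to the degree-zero component is an
  isomorphism; as \<open>K\<close> is a field, \<open>one_not_zero\<close> gives its injectivity.\<close>

locale connected_cochain_dg_algebra = cochain_dg_algebra K A
  for K :: "('a, 'c) ring_scheme" (structure)
    and A :: "('a, 'b, 'm) dg_algebra_scheme" (structure) +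
  assumes component_zero: "component A 0 = (\<lambda>c. c \<odot>\<^bsub>A\<^esub> \<one>\<^bsub>A\<^esub>) ` carrier K"
    and one_not_zero: "\<one>\<^bsub>A\<^esub> \<noteq> \<zero>\<^bsub>A\<^esub>"

section \<open>Subalgebras\<close>

definition restrict_algebra ::
    "('a, 'b, 'm) graded_algebra_scheme \<Rightarrow> 'b set \<Rightarrow> ('a, 'b, 'm) graded_algebra_scheme"
  where "restrict_algebra A S = A\<lparr>carrier := S, component := (\<lambda>i. component A i \<inter> S)\<rparr>"

definition dg_subalgebra ::
    "('a, 'c) ring_scheme \<Rightarrow> ('a, 'b, 'm) dg_algebra_scheme \<Rightarrow> 'b set \<Rightarrow> bool"
  where "dg_subalgebra K A S \<longleftrightarrow>
    submodule S K A \<and> subring S A \<and>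
    (\<forall>x\<in>S. \<exists>f. homogeneous_decomposition A f x \<and> (\<forall>i. f i \<in> S)) \<and>
    (\<forall>x\<in>S. differential A x \<in> S)"

definition fixed_points ::
    "('a, 'b, 'm) graded_algebra_scheme \<Rightarrow> ('b \<Rightarrow> 'b) set \<Rightarrow> 'b set"
  where "fixed_points A G = {a \<in> carrier A. \<forall>g\<in>G. g a = a}"

definition fixed_subalgebra ::
    "('a, 'b, 'm) graded_algebra_scheme \<Rightarrow> ('b \<Rightarrow> 'b) set \<Rightarrow> ('a, 'b, 'm) graded_algebra_scheme"
  where "fixed_subalgebra A G = restrict_algebra A (fixed_points A G)"

section \<open>Morphisms and automorphism groups\<close>

definition graded_algebra_hom ::
    "('a, 'c) ring_scheme \<Rightarrow> ('a, 'b, 'm) graded_algebra_scheme \<Rightarrow>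
      ('a, 'd, 'n) graded_algebra_scheme \<Rightarrow> ('b \<Rightarrow> 'd) set"
  where "graded_algebra_hom K A B = {h \<in> ring_hom A B.
    (\<forall>c\<in>carrier K. \<forall>x\<in>carrier A. h (c \<odot>\<^bsub>A\<^esub> x) = c \<odot>\<^bsub>B\<^esub> h x) \<and>
    (\<forall>i. \<forall>x\<in>component A i. h x \<in> component B i)}"

definition dg_algebra_hom ::
    "('a, 'c) ring_scheme \<Rightarrow> ('a, 'b, 'm) dg_algebra_scheme \<Rightarrow>
      ('a, 'd, 'n) dg_algebra_scheme \<Rightarrow> ('b \<Rightarrow> 'd) set"
  where "dg_algebra_hom K A B = {h \<in> graded_algebra_hom K A B.
    \<forall>x\<in>carrier A. h (differential A x) = differential B (h x)}"

definition graded_algebra_iso ::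
    "('a, 'c) ring_scheme \<Rightarrow> ('a, 'b, 'm) graded_algebra_scheme \<Rightarrow>
      ('a, 'd, 'n) graded_algebra_scheme \<Rightarrow> ('b \<Rightarrow> 'd) set"
  where "graded_algebra_iso K A B =
    {h \<in> graded_algebra_hom K A B. bij_betw h (carrier A) (carrier B)}"

text \<open>As for \<open>AutoGroup\<close>, automorphisms are extensional functions on the carrier, and the
  group law is composition on the carrier.\<close>

definition Aut_gr ::
    "('a, 'c) ring_scheme \<Rightarrow> ('a, 'b, 'm) graded_algebra_scheme \<Rightarrow> ('b \<Rightarrow> 'b) monoid"
  where "Aut_gr K A =
    BijGroup (carrier A) \<lparr>carrier := graded_algebra_hom K A A \<inter> Bij (carrier A)\<rparr>"

definition Aut_dg ::
    "('a, 'c) ring_scheme \<Rightarrow> ('a, 'b, 'm) dg_algebra_scheme \<Rightarrow> ('b \<Rightarrow> 'b) monoid"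
  where "Aut_dg K A =
    BijGroup (carrier A) \<lparr>carrier := dg_algebra_hom K A A \<inter> Bij (carrier A)\<rparr>"

section \<open>Cohomology\<close>

definition cocycles :: "('a, 'b, 'm) dg_algebra_scheme \<Rightarrow> 'b set"
  where "cocycles A = {x \<in> carrier A. differential A x = \<zero>\<^bsub>A\<^esub>}"

definition coboundaries :: "('a, 'b, 'm) dg_algebra_scheme \<Rightarrow> 'b set"
  where "coboundaries A = differential A ` carrier A"

text \<open>The underlying ring is the library quotient of the ring of cocycles by the ideal of
  coboundaries. The scalar action is given on cosets without choosing representatives, in
  the style of \<open>rcoset_mult\<close>; the component of degree \<open>i\<close> consists of the classes of the
  cocycles of degree \<open>i\<close>.\<close>

definition cohomology ::
    "('a, 'b, 'm) dg_algebra_scheme \<Rightarrow> ('a, 'b set) graded_algebra"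
  where "cohomology A =
    (let Q = (A\<lparr>carrier := cocycles A\<rparr>) Quot (coboundaries A) in
      \<lparr>carrier = carrier Q, mult = mult Q, one = one Q, zero = zero Q, add = add Q,
       smult = (\<lambda>c X. \<Union>x\<in>X. coboundaries A +>\<^bsub>A\<^esub> (c \<odot>\<^bsub>A\<^esub> x)),
       component = (\<lambda>i. (\<lambda>x. coboundaries A +>\<^bsub>A\<^esub> x) ` (cocycles A \<inter> component A i))\<rparr>)"

definition cohomology_map ::
    "('a, 'b, 'm) dg_algebra_scheme \<Rightarrow> ('a, 'd, 'n) dg_algebra_scheme \<Rightarrow>
      ('b \<Rightarrow> 'd) \<Rightarrow> 'b set \<Rightarrow> 'd set"
  where "cohomology_map A B f =
    (\<lambda>X \<in> carrier (cohomology A). \<Union>x\<in>X. coboundaries B +>\<^bsub>B\<^esub> f x)"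

end

theory Submission
  imports Defs
begin

text \<open>The fixed points of a group of DG automorphisms are stable under all operations of \<open>A\<close>. They
are also spanned by homogeneous elements: a graded map sends the homogeneous decomposition of a
fixed element to a decomposition of the same element, so it fixes each homogeneous part
(\<open>graded_hom_fixes_components\<close>). In degree zero there are only multiples of \<open>\<one>\<close>, and these are
always fixed, so the fixed subalgebra is again connected.

Cohomology is functorial: cocycles form a subring, coboundaries form an ideal in it
(\<open>coboundaries_ideal\<close>), and a DG map acts on a coset through any representative
(\<open>cohomology_map_class\<close>). Compositions and the identity are respected, so \<open>G\<close> acts on
cohomology by graded automorphisms (\<open>cohomology_action_subgroup\<close>). The inverse of an element of
\<open>G\<close> is found within \<open>G\<close> by finiteness: left translation is an injective self-map of a
finite set.

For the isomorphism the order of \<open>G\<close> is assumed to be invertible in \<open>K\<close>. Averaging the translates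
of an element over \<open>G\<close> is then a linear, degree-preserving projection onto the fixed points that
commutes with the differential. Averaging a cocycle whose class is fixed changes it only by a
coboundary, so every fixed class contains a fixed cocycle (\<open>fixed_cohomology_representatives\<close>).
Averaging a primitive of a fixed coboundary gives a fixed primitive, so the coboundaries of the
fixed subalgebra are precisely the fixed coboundaries (\<open>coboundaries_fixed_subalgebra\<close>). Together these
say that intersecting a fixed class with the fixed points gives exactly one class of the fixed
subalgebra, and \<open>\<lambda>X. X \<inter> fixed_points A G\<close> is the isomorphism sought
(\<open>fixed_cohomology_iso\<close>).\<close>

section \<open>Sums, submodules and homogeneous decompositions\<close>

text \<open>Over a ring with unit, negation is the scalar action of \<open>\<ominus> \<one>\<close>, so closure under it is automatic.\<close>

lemma (in module) submoduleI_without_inverses: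
  assumes "H \<subseteq> carrier M" and "\<zero>\<^bsub>M\<^esub> \<in> H"
    and add: "\<And>x y. \<lbrakk>x \<in> H; y \<in> H\<rbrakk> \<Longrightarrow> x \<oplus>\<^bsub>M\<^esub> y \<in> H"
    and smult: "\<And>c x. \<lbrakk>c \<in> carrier R; x \<in> H\<rbrakk> \<Longrightarrow> c \<odot>\<^bsub>M\<^esub> x \<in> H"
  shows "submodule H R M"
proof (rule submoduleI)
  fix x assume x: "x \<in> H"
  then have "x \<in> carrier M" using assms(1) by blast
  then have "\<ominus>\<^bsub>M\<^esub> x = (\<ominus> \<one>) \<odot>\<^bsub>M\<^esub> x"
    by (simp add: smult_l_minus)
  then show "\<ominus>\<^bsub>M\<^esub> x \<in> H" using smult x by simp
qed (use assms in auto)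

text \<open>A finite sum is defined by folding inside the carrier, so its value in a smaller structure has to
be compared by induction; this is what lets homogeneous decompositions pass to subalgebras.\<close>

lemma finsum_subcarrier:
  assumes "abelian_monoid A" and "abelian_monoid A'"
    and "carrier A' \<subseteq> carrier A" and "add A' = add A" and "zero A' = zero A"
    and "f \<in> I \<rightarrow> carrier A'"
  shows "finsum A' f I = finsum A f I"
  using assms(6)
proof (induction I rule: infinite_finite_induct)
  case (infinite I)
  then show ?case
    using assms(1,2,5) by (simp add: abelian_monoid.finsum_infinite)
next
  case empty
  then show ?case
    using assms(1,2,5) by (simp add: abelian_monoid.finsum_empty)
next
  case (insert i I)
  have "f \<in> I \<rightarrow> carrier A" "f i \<in> carrier A" using insert.prems assms(3) by auto
  then show ?case
    using insert assms by (simp add: abelian_monoid.finsum_insert)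
qed

lemma (in abelian_group) additive_zero:
  assumes "\<And>x. x \<in> carrier G \<Longrightarrow> T x \<in> carrier G"
    and "\<And>x y. \<lbrakk>x \<in> carrier G; y \<in> carrier G\<rbrakk> \<Longrightarrow> T (x \<oplus> y) = T x \<oplus> T y"
  shows "T \<zero> = \<zero>"
  by (metis assms add.l_cancel_one' add.one_closed l_zero)

lemma (in abelian_group) additive_finsum:
  assumes "\<And>x. x \<in> carrier G \<Longrightarrow> T x \<in> carrier G"
    and "\<And>x y. \<lbrakk>x \<in> carrier G; y \<in> carrier G\<rbrakk> \<Longrightarrow> T (x \<oplus> y) = T x \<oplus> T y"
    and "f \<in> I \<rightarrow> carrier G"
  shows "T (finsum G f I) = finsum G (\<lambda>i. T (f i)) I"
  using assms(3)
proof (induction I rule: infinite_finite_induct)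
  case (insert i I)
  have "f \<in> I \<rightarrow> carrier G" "f i \<in> carrier G" using insert.prems by auto
  moreover have "(\<lambda>i. T (f i)) \<in> I \<rightarrow> carrier G" using insert.prems assms(1) by auto
  ultimately show ?case
    using insert assms by simp
qed (use additive_zero[of T] assms in simp_all)

context graded_algebra
begin

lemma component_carrier: "x \<in> component A i \<Longrightarrow> x \<in> carrier A"
  using submoduleE(1)[OF component_submodule] by blast

lemma zero_component: "\<zero>\<^bsub>A\<^esub> \<in> component A i"
  using submodule.axioms(1)[OF component_submodule, THEN subgroup.one_closed] by simp

lemma finsum_in_submodule:
  assumes "submodule S K A" and "f \<in> I \<rightarrow> S"
  shows "finsum A f I \<in> S"
  using assms(2)
proof (induction I rule: infinite_finite_induct)
  case (insert i I)
  have "f \<in> I \<rightarrow> carrier A" "f i \<in> carrier A"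
    using insert.prems submoduleE(1)[OF assms(1)] by auto
  then show ?case
    using insert submoduleE(5)[OF assms(1)] by simp
qed (use submodule.axioms(1)[OF assms(1), THEN subgroup.one_closed] in simp_all)

text \<open>The definition sums over the exact support, which is awkward to compute for a derived family; any
finite index set outside which the family vanishes gives the same sum.\<close>

lemma homogeneous_decompositionI:
  assumes f: "\<And>i. f i \<in> component A i" and I: "finite I" "\<And>i. i \<notin> I \<Longrightarrow> f i = \<zero>\<^bsub>A\<^esub>"
    and x: "x = finsum A f I"
  shows "homogeneous_decomposition A f x"
proof -
  have sub: "{i. f i \<noteq> \<zero>\<^bsub>A\<^esub>} \<subseteq> I" using I(2) by blast
  have "finsum A f {i. f i \<noteq> \<zero>\<^bsub>A\<^esub>} = finsum A f I"
    by (rule A.add.finprod_mono_neutral_cong_left)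
      (use sub I component_carrier[OF f] in auto)
  then show ?thesis
    unfolding homogeneous_decomposition_def
    using f x finite_subset[OF sub I(1)] by simp
qed

lemma homogeneous_decompositionE:
  assumes "homogeneous_decomposition A f x"
  obtains "\<And>i. f i \<in> component A i" and "\<And>i. f i \<in> carrier A"
    and "finite {i. f i \<noteq> \<zero>\<^bsub>A\<^esub>}" and "x = (\<Oplus>\<^bsub>A\<^esub>i\<in>{i. f i \<noteq> \<zero>\<^bsub>A\<^esub>}. f i)" and "x \<in> carrier A"
proof -
  have c: "f i \<in> component A i" for i
    using assms unfolding homogeneous_decomposition_def by blast
  then have "f i \<in> carrier A" for i using component_carrier by blast
  then show thesis
    using that c assms unfolding homogeneous_decomposition_def by auto
qed

lemma homogeneous_decomposition_unique:
  assumes "homogeneous_decomposition A f x" and "homogeneous_decomposition A f' x"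
  shows "f = f'"
  using assms direct_sum by (metis homogeneous_decompositionE)

text \<open>An additive map of degree \<open>s\<close> carries decompositions to decompositions shifted by \<open>s\<close>. The cases
of interest are graded endomorphisms (\<open>s = 0\<close>) and the differential (\<open>s = 1\<close>).\<close>

lemma homogeneous_decomposition_additive:
  assumes f: "homogeneous_decomposition A f x"
    and closed: "\<And>y. y \<in> carrier A \<Longrightarrow> T y \<in> carrier A"
    and add: "\<And>y z. \<lbrakk>y \<in> carrier A; z \<in> carrier A\<rbrakk> \<Longrightarrow> T (y \<oplus>\<^bsub>A\<^esub> z) = T y \<oplus>\<^bsub>A\<^esub> T z"
    and degree: "\<And>i y. y \<in> component A i \<Longrightarrow> T y \<in> component A (i + s)"
  shows "homogeneous_decomposition A (\<lambda>j. if j < s then \<zero>\<^bsub>A\<^esub> else T (f (j - s))) (T x)"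
    (is "homogeneous_decomposition A ?f _")
  using f
proof (rule homogeneous_decompositionE)
  let ?I = "{i. f i \<noteq> \<zero>\<^bsub>A\<^esub>}"
  assume c: "\<And>i. f i \<in> component A i" "\<And>i. f i \<in> carrier A" and fin: "finite ?I"
    and x: "x = (\<Oplus>\<^bsub>A\<^esub>i\<in>?I. f i)"
  have T0: "T \<zero>\<^bsub>A\<^esub> = \<zero>\<^bsub>A\<^esub>" using A.additive_zero closed add by blast
  show ?thesis
  proof (rule homogeneous_decompositionI[where I = "(\<lambda>i. i + s) ` ?I"])
    show "?f j \<in> component A j" for j
      using degree[OF c(1), of "j - s"] zero_component by (cases "j < s") auto
    show "?f j = \<zero>\<^bsub>A\<^esub>" if "j \<notin> (\<lambda>i. i + s) ` ?I" for j
    proof (cases "j < s")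
      case False
      then have "f (j - s) = \<zero>\<^bsub>A\<^esub>" using that by (force simp: image_iff)
      then show ?thesis using T0 by simp
    qed simp
    have "finsum A ?f ((\<lambda>i. i + s) ` ?I) = (\<Oplus>\<^bsub>A\<^esub>i\<in>?I. T (f i))"
      using closed c(2) by (subst A.finsum_reindex) auto
    also have "\<dots> = T x"
      unfolding x using A.additive_finsum[of T f ?I] closed add c(2) by simp
    finally show "T x = finsum A ?f ((\<lambda>i. i + s) ` ?I)" by simp
  qed (use fin in simp)
qed

lemma graded_hom_simps:
  assumes "h \<in> graded_algebra_hom K A A"
  shows "x \<in> carrier A \<Longrightarrow> h x \<in> carrier A"
    and "\<lbrakk>x \<in> carrier A; y \<in> carrier A\<rbrakk> \<Longrightarrow> h (x \<oplus>\<^bsub>A\<^esub> y) = h x \<oplus>\<^bsub>A\<^esub> h y"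
    and "\<lbrakk>x \<in> carrier A; y \<in> carrier A\<rbrakk> \<Longrightarrow> h (x \<otimes>\<^bsub>A\<^esub> y) = h x \<otimes>\<^bsub>A\<^esub> h y"
    and "\<lbrakk>c \<in> carrier K; x \<in> carrier A\<rbrakk> \<Longrightarrow> h (c \<odot>\<^bsub>A\<^esub> x) = c \<odot>\<^bsub>A\<^esub> h x"
    and "h \<one>\<^bsub>A\<^esub> = \<one>\<^bsub>A\<^esub>" and "h \<zero>\<^bsub>A\<^esub> = \<zero>\<^bsub>A\<^esub>"
    and "x \<in> component A i \<Longrightarrow> h x \<in> component A i"
proof -
  have r: "h \<in> ring_hom A A" using assms unfolding graded_algebra_hom_def by blast
  show "x \<in> carrier A \<Longrightarrow> h x \<in> carrier A" by (rule ring_hom_closed[OF r])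
  show "\<lbrakk>x \<in> carrier A; y \<in> carrier A\<rbrakk> \<Longrightarrow> h (x \<oplus>\<^bsub>A\<^esub> y) = h x \<oplus>\<^bsub>A\<^esub> h y"
    by (rule ring_hom_add[OF r])
  show "\<lbrakk>x \<in> carrier A; y \<in> carrier A\<rbrakk> \<Longrightarrow> h (x \<otimes>\<^bsub>A\<^esub> y) = h x \<otimes>\<^bsub>A\<^esub> h y"
    by (rule ring_hom_mult[OF r])
  show "h \<one>\<^bsub>A\<^esub> = \<one>\<^bsub>A\<^esub>" by (rule ring_hom_one[OF r])
  show "h \<zero>\<^bsub>A\<^esub> = \<zero>\<^bsub>A\<^esub>" using ring_hom_zero[OF r] A.ring_axioms by blast
qed (use assms in \<open>auto simp: graded_algebra_hom_def\<close>)

text \<open>Both \<open>f\<close> and its image under \<open>h\<close> decompose \<open>x\<close>, so uniqueness identifies them. This is why fixed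
points form a graded subspace.\<close>

lemma graded_hom_fixes_components:
  assumes h: "h \<in> graded_algebra_hom K A A" and f: "homogeneous_decomposition A f x"
    and x: "h x = x"
  shows "h (f i) = f i"
proof -
  have "homogeneous_decomposition A (\<lambda>j. h (f j)) x"
    using homogeneous_decomposition_additive[OF f, of h 0] graded_hom_simps[OF h] x by simp
  from homogeneous_decomposition_unique[OF this f] show ?thesis by (rule fun_cong)
qed

lemma carrier_submodule: "submodule (carrier A) K A"
  by (rule submoduleI_without_inverses) auto

lemma homogeneous_decomposition_restrict:
  assumes "submodule S K A" and "abelian_monoid (restrict_algebra A S)"
  shows "homogeneous_decomposition (restrict_algebra A S) f x \<longleftrightarrow>
    homogeneous_decomposition A f x \<and> (\<forall>i. f i \<in> S)"
proof -
  have "finsum (restrict_algebra A S) f I = finsum A f I" if "\<forall>i. f i \<in> S" for I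
    by (rule finsum_subcarrier)
      (use that assms submoduleE(1)[OF assms(1)] A.abelian_monoid_axioms
       in \<open>auto simp: restrict_algebra_def\<close>)
  then show ?thesis
    by (auto simp: homogeneous_decomposition_def restrict_algebra_def)
qed

end

text \<open>The axioms are inherited once the notions defined through the carrier are compared: finite sums, in
the homogeneous decompositions, and additive inversion, in the sign of the Leibniz rule. Inversion
agrees in both structures because it is given by a scalar.\<close>

lemma (in cochain_dg_algebra) cochain_dg_algebra_restrict:
  assumes S: "dg_subalgebra K A S"
  shows "cochain_dg_algebra K (restrict_algebra A S)"
proof -
  let ?S = "restrict_algebra A S"
  have sub: "submodule S K A" and ring: "subring S A"
    using S unfolding dg_subalgebra_def by auto
  have SA: "\<And>x. x \<in> S \<Longrightarrow> x \<in> carrier A" using submoduleE(1)[OF sub] by blast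
  have sel [simp]: "carrier ?S = S" "mult ?S = mult A" "one ?S = one A" "zero ?S = zero A"
    "add ?S = add A" "smult ?S = smult A" "differential ?S = differential A"
    "component ?S = (\<lambda>i. component A i \<inter> S)"
    by (simp_all add: restrict_algebra_def)
  have "ring (A\<lparr>carrier := S\<rparr>)" by (rule A.subring_is_ring[OF ring])
  then have rS: "ring ?S"
    unfolding ring_def abelian_group_def abelian_monoid_def abelian_group_axioms_def
      monoid_def ring_axioms_def by simp
  interpret S: ring ?S by (rule rS)
  have mS: "module K ?S"
    by (rule moduleI) (use S.abelian_group_axioms K.cring_axioms sub submoduleE SA in
        \<open>auto simp: smult_l_distr smult_r_distr smult_assoc1 intro: submoduleE(4)\<close>)
  interpret S: module K ?S by (rule mS)
  have minus: "\<ominus>\<^bsub>?S\<^esub> x = \<ominus>\<^bsub>A\<^esub> x" if "x \<in> S" for x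
    using smult_l_minus[of "\<one>\<^bsub>K\<^esub>" x] S.smult_l_minus[of "\<one>\<^bsub>K\<^esub>" x] that SA by simp
  have pow: "x [^]\<^bsub>?S\<^esub> (n::nat) = x [^]\<^bsub>A\<^esub> n" for x n
    by (simp add: nat_pow_def)
  note decomp = homogeneous_decomposition_restrict[OF sub S.abelian_monoid_axioms]
  have "graded_algebra K ?S"
  proof (intro graded_algebra.intro graded_algebra_axioms.intro)
    show "submodule (component ?S i) K ?S" for i
    proof (rule S.submoduleI_without_inverses)
      show "x \<oplus>\<^bsub>?S\<^esub> y \<in> component ?S i" if "x \<in> component ?S i" "y \<in> component ?S i" for x y
        using that submoduleE(5)[OF component_submodule] submoduleE(5)[OF sub] by simp
      show "c \<odot>\<^bsub>?S\<^esub> x \<in> component ?S i" if "c \<in> carrier K" "x \<in> component ?S i" for c x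
        using that submoduleE(4)[OF component_submodule] submoduleE(4)[OF sub] by simp
    qed (use zero_component S.zero_closed in auto)
    show "\<exists>!f. homogeneous_decomposition ?S f x" if x: "x \<in> carrier ?S" for x
    proof -
      obtain f where f: "homogeneous_decomposition A f x" "\<forall>i. f i \<in> S"
        using x S unfolding dg_subalgebra_def by auto
      then show ?thesis
        unfolding decomp using homogeneous_decomposition_unique by blast
    qed
  qed (use K.field_axioms rS mS SA smult_mult_left smult_mult_right one_component mult_component
         S.one_closed S.m_closed in auto)
  then show ?thesis
  proof (intro cochain_dg_algebra.intro cochain_dg_algebra_axioms.intro)
    show "differential ?S (x \<otimes>\<^bsub>?S\<^esub> y) = differential ?S x \<otimes>\<^bsub>?S\<^esub> y \<oplus>\<^bsub>?S\<^esub>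
        (\<ominus>\<^bsub>?S\<^esub> \<one>\<^bsub>?S\<^esub>) [^]\<^bsub>?S\<^esub> i \<otimes>\<^bsub>?S\<^esub> (x \<otimes>\<^bsub>?S\<^esub> differential ?S y)"
      if "x \<in> component ?S i" "y \<in> carrier ?S" for x y i
      using that leibniz[of x i y] SA minus S.one_closed pow by simp
  qed (use S SA differential_add differential_smult differential_degree differential_squared
       in \<open>auto simp: dg_subalgebra_def\<close>)
qed

section \<open>Cohomology as a functor\<close>

lemma (in graded_algebra) homogeneous_induct [consumes 1, case_names homogeneous add]:
  assumes "x \<in> carrier A"
    and homogeneous: "\<And>i y. y \<in> component A i \<Longrightarrow> P y"
    and add: "\<And>y z. \<lbrakk>y \<in> carrier A; z \<in> carrier A; P y; P z\<rbrakk> \<Longrightarrow> P (y \<oplus>\<^bsub>A\<^esub> z)"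
  shows "P x"
proof -
  obtain f where f: "homogeneous_decomposition A f x" using direct_sum assms(1) by blast
  then show ?thesis
  proof (rule homogeneous_decompositionE)
    assume c: "\<And>i. f i \<in> component A i" "\<And>i. f i \<in> carrier A"
      and x: "x = (\<Oplus>\<^bsub>A\<^esub>i\<in>{i. f i \<noteq> \<zero>\<^bsub>A\<^esub>}. f i)"
    have "P (finsum A f I)" for I
    proof (induction I rule: infinite_finite_induct)
      case (insert i I)
      moreover have "finsum A f I \<in> carrier A" using c(2) by (simp add: Pi_def)
      ultimately show ?case using add[OF c(2) _ homogeneous[OF c(1)]] c(2) by simp
    qed (use homogeneous zero_component in auto)
    then show ?thesis unfolding x by simp
  qed
qed

lemma a_r_coset_carrier_update: "a_r_coset (A\<lparr>carrier := S\<rparr>) = a_r_coset A"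
  by (simp add: fun_eq_iff a_r_coset_def r_coset_def)

abbreviation cohomology_class :: "('a, 'b, 'm) dg_algebra_scheme \<Rightarrow> 'b \<Rightarrow> 'b set"
  where "cohomology_class A x \<equiv> coboundaries A +>\<^bsub>A\<^esub> x"

context cochain_dg_algebra
begin

lemma differential_zero: "differential A \<zero>\<^bsub>A\<^esub> = \<zero>\<^bsub>A\<^esub>"
  using A.additive_zero differential_closed differential_add by blast

lemma cocycles_submodule: "submodule (cocycles A) K A"
  by (rule submoduleI_without_inverses)
    (auto simp: cocycles_def differential_zero differential_add differential_smult)

lemma coboundaries_submodule: "submodule (coboundaries A) K A"
proof (rule submoduleI_without_inverses)
  show "\<zero>\<^bsub>A\<^esub> \<in> coboundaries A"
    unfolding coboundaries_def using differential_zero A.zero_closed by (metis image_eqI)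
  show "x \<oplus>\<^bsub>A\<^esub> y \<in> coboundaries A" if xy: "x \<in> coboundaries A" "y \<in> coboundaries A" for x y
  proof -
    obtain u v where "u \<in> carrier A" "v \<in> carrier A" "x = differential A u" "y = differential A v"
      using xy unfolding coboundaries_def by blast
    then show ?thesis
      unfolding coboundaries_def by (intro image_eqI[of _ _ "u \<oplus>\<^bsub>A\<^esub> v"]) (simp_all add: differential_add)
  qed
  show "c \<odot>\<^bsub>A\<^esub> x \<in> coboundaries A" if c: "c \<in> carrier K" and x: "x \<in> coboundaries A" for c x
  proof -
    obtain u where "u \<in> carrier A" "x = differential A u"
      using x unfolding coboundaries_def by blast
    then show ?thesis
      using c unfolding coboundaries_def by (intro image_eqI[of _ _ "c \<odot>\<^bsub>A\<^esub> u"]) (simp_all add: differential_smult)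
  qed
qed (auto simp: coboundaries_def differential_closed)

lemma coboundaries_subset_cocycles: "coboundaries A \<subseteq> cocycles A"
  by (auto simp: coboundaries_def cocycles_def differential_closed differential_squared)

text \<open>The differentials of the homogeneous parts lie in distinct degrees and add up to zero, so each of
them vanishes. The Leibniz rule speaks of homogeneous left factors only; this lemma makes it usable
for arbitrary cocycles.\<close>

lemma cocycle_homogeneous_part:
  assumes f: "homogeneous_decomposition A f x" and x: "x \<in> cocycles A"
  shows "f i \<in> cocycles A"
proof -
  \<comment> \<open>The shifted family is evaluated at \<open>Suc i\<close> below, where it is the differential of \<open>f i\<close>.\<close>
  have "homogeneous_decomposition A (\<lambda>j. if j < 1 then \<zero>\<^bsub>A\<^esub> else differential A (f (j - 1))) \<zero>\<^bsub>A\<^esub>"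
    using homogeneous_decomposition_additive[OF f, of "differential A" 1] x
      differential_closed differential_add differential_degree by (simp add: cocycles_def)
  moreover have "homogeneous_decomposition A (\<lambda>j. \<zero>\<^bsub>A\<^esub>) \<zero>\<^bsub>A\<^esub>"
    by (rule homogeneous_decompositionI[of _ "{}"]) (use zero_component in auto)
  ultimately have "(\<lambda>j. if j < 1 then \<zero>\<^bsub>A\<^esub> else differential A (f (j - 1))) = (\<lambda>j. \<zero>\<^bsub>A\<^esub>)"
    by (rule homogeneous_decomposition_unique)
  from fun_cong[OF this, of "Suc i"] have "differential A (f i) = \<zero>\<^bsub>A\<^esub>" by simp
  moreover have "f i \<in> carrier A" using f by (rule homogeneous_decompositionE)
  ultimately show ?thesis by (simp add: cocycles_def)
qed

text \<open>The signed term of the Leibniz rule carries the factor \<open>differential A y = \<zero>\<close>, so no sign that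
depends on the degree of \<open>u\<close> survives and the formula extends additively from homogeneous \<open>u\<close>.\<close>

lemma differential_mult_cocycle:
  assumes u: "u \<in> carrier A" and y: "y \<in> cocycles A"
  shows "differential A (u \<otimes>\<^bsub>A\<^esub> y) = differential A u \<otimes>\<^bsub>A\<^esub> y"
  using u
proof (induction u rule: homogeneous_induct)
  case (homogeneous i u)
  have "u \<in> carrier A" "y \<in> carrier A" "differential A y = \<zero>\<^bsub>A\<^esub>"
    using homogeneous component_carrier y by (auto simp: cocycles_def)
  then show ?case
    using leibniz[OF homogeneous, of y] by (simp add: differential_closed)
next
  case (add u v)
  then show ?case
    using y by (simp add: cocycles_def A.l_distr differential_add differential_closed)
qed

lemma cocycles_mult_closed:
  assumes "x \<in> cocycles A" and "y \<in> cocycles A"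
  shows "x \<otimes>\<^bsub>A\<^esub> y \<in> cocycles A"
  using assms differential_mult_cocycle[of x y] by (simp add: cocycles_def)

text \<open>The Leibniz rule for \<open>\<one> \<otimes> \<one>\<close> says that the differential of \<open>\<one>\<close> is twice itself.\<close>

lemma one_cocycle: "\<one>\<^bsub>A\<^esub> \<in> cocycles A"
proof -
  let ?d = "differential A \<one>\<^bsub>A\<^esub>"
  have d: "?d \<in> carrier A" by (simp add: differential_closed)
  have "?d = ?d \<oplus>\<^bsub>A\<^esub> ?d"
    using leibniz[OF one_component, of "\<one>\<^bsub>A\<^esub>"] d by simp
  then have "?d = \<zero>\<^bsub>A\<^esub>" using d by (metis A.add.l_cancel_one')
  then show ?thesis by (simp add: cocycles_def)
qed

lemma coboundary_mult_cocycle: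
  assumes "b \<in> coboundaries A" and y: "y \<in> cocycles A"
  shows "b \<otimes>\<^bsub>A\<^esub> y \<in> coboundaries A"
proof -
  obtain u where u: "u \<in> carrier A" "b = differential A u"
    using assms(1) by (auto simp: coboundaries_def)
  have "y \<in> carrier A" using y by (simp add: cocycles_def)
  then show ?thesis
    using u differential_mult_cocycle[OF u(1) y] unfolding coboundaries_def by (metis A.m_closed image_eqI)
qed

text \<open>For a homogeneous cocycle \<open>y\<close> the Leibniz rule gives \<open>d (y u) = \<plusminus> y (d u)\<close>. The sign depends on
the degree, so a general cocycle is treated one homogeneous part at a time.\<close>

lemma cocycle_mult_coboundary:
  assumes x: "x \<in> cocycles A" and "b \<in> coboundaries A"
  shows "x \<otimes>\<^bsub>A\<^esub> b \<in> coboundaries A"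
proof -
  obtain u where u: "u \<in> carrier A" "b = differential A u"
    using assms(2) by (auto simp: coboundaries_def)
  have b: "b \<in> carrier A" using u differential_closed by simp
  have homogeneous: "y \<otimes>\<^bsub>A\<^esub> b \<in> coboundaries A" if y: "y \<in> component A i" "y \<in> cocycles A" for y i
  proof -
    have yc: "y \<in> carrier A" using y by (simp add: cocycles_def)
    have sign: "(\<ominus>\<^bsub>A\<^esub> \<one>\<^bsub>A\<^esub>) [^]\<^bsub>A\<^esub> i = \<one>\<^bsub>A\<^esub> \<or> (\<ominus>\<^bsub>A\<^esub> \<one>\<^bsub>A\<^esub>) [^]\<^bsub>A\<^esub> i = \<ominus>\<^bsub>A\<^esub> \<one>\<^bsub>A\<^esub>"
      by (induction i) (auto simp: A.l_minus)
    have "(\<ominus>\<^bsub>A\<^esub> \<one>\<^bsub>A\<^esub>) [^]\<^bsub>A\<^esub> i \<otimes>\<^bsub>A\<^esub> (y \<otimes>\<^bsub>A\<^esub> b) = differential A (y \<otimes>\<^bsub>A\<^esub> u)"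
      using leibniz[OF y(1) u(1)] y u yc b by (simp add: cocycles_def)
    then have "(\<ominus>\<^bsub>A\<^esub> \<one>\<^bsub>A\<^esub>) [^]\<^bsub>A\<^esub> i \<otimes>\<^bsub>A\<^esub> (y \<otimes>\<^bsub>A\<^esub> b) \<in> coboundaries A"
      using yc u(1) by (simp add: coboundaries_def)
    then have "y \<otimes>\<^bsub>A\<^esub> b \<in> coboundaries A \<or> \<ominus>\<^bsub>A\<^esub> (y \<otimes>\<^bsub>A\<^esub> b) \<in> coboundaries A"
      using sign yc b by (auto simp: A.l_minus)
    then show ?thesis
      using submoduleE(3)[OF coboundaries_submodule, of "\<ominus>\<^bsub>A\<^esub> (y \<otimes>\<^bsub>A\<^esub> b)"] yc b by auto
  qed
  obtain f where f: "homogeneous_decomposition A f x"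
    using direct_sum x unfolding cocycles_def by blast
  then show ?thesis
  proof (rule homogeneous_decompositionE)
    let ?I = "{i. f i \<noteq> \<zero>\<^bsub>A\<^esub>}"
    assume c: "\<And>i. f i \<in> component A i" "\<And>i. f i \<in> carrier A" and "finite ?I"
      and x': "x = (\<Oplus>\<^bsub>A\<^esub>i\<in>?I. f i)"
    then have "x \<otimes>\<^bsub>A\<^esub> b = (\<Oplus>\<^bsub>A\<^esub>i\<in>?I. f i \<otimes>\<^bsub>A\<^esub> b)"
      using A.finsum_ldistr[of ?I b f] b by auto
    also have "\<dots> \<in> coboundaries A"
      using homogeneous[OF c(1) cocycle_homogeneous_part[OF f x]]
      by (intro finsum_in_submodule[OF coboundaries_submodule]) auto
    finally show ?thesis .
  qed
qed

lemma cocycles_subring: "subring (cocycles A) A"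
  by (rule A.subringI[OF submoduleE(1)[OF cocycles_submodule] one_cocycle submoduleE(3)[OF cocycles_submodule]
        cocycles_mult_closed submoduleE(5)[OF cocycles_submodule]])

lemma coboundaries_ideal: "ideal (coboundaries A) (A\<lparr>carrier := cocycles A\<rparr>)"
proof (rule idealI)
  show "ring (A\<lparr>carrier := cocycles A\<rparr>)" by (rule A.subring_is_ring[OF cocycles_subring])
  show "subgroup (coboundaries A) (add_monoid (A\<lparr>carrier := cocycles A\<rparr>))"
    using A.add.subgroup_incl[of "coboundaries A" "cocycles A"] coboundaries_subset_cocycles
      submodule.axioms(1)[OF coboundaries_submodule] submodule.axioms(1)[OF cocycles_submodule]
    by simp
next
  show "x \<otimes>\<^bsub>A\<lparr>carrier := cocycles A\<rparr>\<^esub> b \<in> coboundaries A"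
    if "b \<in> coboundaries A" "x \<in> carrier (A\<lparr>carrier := cocycles A\<rparr>)" for b x
    using that cocycle_mult_coboundary by simp
  show "b \<otimes>\<^bsub>A\<lparr>carrier := cocycles A\<rparr>\<^esub> x \<in> coboundaries A"
    if "b \<in> coboundaries A" "x \<in> carrier (A\<lparr>carrier := cocycles A\<rparr>)" for b x
    using that coboundary_mult_cocycle by simp
qed

lemma mem_cohomology_class:
  "y \<in> cohomology_class A x \<longleftrightarrow> (\<exists>u\<in>carrier A. y = differential A u \<oplus>\<^bsub>A\<^esub> x)"
  unfolding a_r_coset_def' coboundaries_def by blast

lemma abelian_subgroup_coboundaries: "abelian_subgroup (coboundaries A) A"
  using submodule.axioms(1)[OF coboundaries_submodule] A.abelian_group_axioms
  by (simp add: abelian_subgroupI3 additive_subgroup.intro)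

lemma cohomology_class_self: "x \<in> carrier A \<Longrightarrow> x \<in> cohomology_class A x"
  by (rule abelian_subgroup.a_rcos_self[OF abelian_subgroup_coboundaries])

lemma cohomology_class_eq:
  assumes "x \<in> carrier A" and "y \<in> cohomology_class A x"
  shows "cohomology_class A y = cohomology_class A x"
  using A.a_repr_independence[OF assms(2,1) submodule.axioms(1)[OF coboundaries_submodule]] by (rule sym)

lemma cohomology_class_shift:
  assumes "x \<in> carrier A" and "u \<in> carrier A"
  shows "cohomology_class A (differential A u \<oplus>\<^bsub>A\<^esub> x) = cohomology_class A x"
proof (rule cohomology_class_eq[OF assms(1)])
  show "differential A u \<oplus>\<^bsub>A\<^esub> x \<in> cohomology_class A x"
    unfolding mem_cohomology_class by (rule bexI[of _ u]) (simp_all add: assms(2))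
qed

lemma cohomology_class_minus_mem:
  assumes "x \<in> carrier A" and "y \<in> carrier A" and "cohomology_class A y = cohomology_class A x"
  shows "y \<ominus>\<^bsub>A\<^esub> x \<in> coboundaries A"
proof -
  obtain u where "u \<in> carrier A" "y = differential A u \<oplus>\<^bsub>A\<^esub> x"
    using cohomology_class_self[of y] assms mem_cohomology_class by blast
  then have "y \<ominus>\<^bsub>A\<^esub> x = differential A u"
    using assms(1) differential_closed by (simp add: a_minus_def A.add.m_assoc A.r_neg)
  then show ?thesis using \<open>u \<in> carrier A\<close> by (simp add: coboundaries_def)
qed

lemma cohomology_class_eqI:
  assumes "x \<in> carrier A" and "y \<in> carrier A" and "y \<ominus>\<^bsub>A\<^esub> x \<in> coboundaries A"
  shows "cohomology_class A y = cohomology_class A x"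
proof -
  obtain u where u: "u \<in> carrier A" "y \<ominus>\<^bsub>A\<^esub> x = differential A u"
    using assms(3) by (auto simp: coboundaries_def)
  have "y = (y \<ominus>\<^bsub>A\<^esub> x) \<oplus>\<^bsub>A\<^esub> x"
    using assms(1,2) by (simp add: a_minus_def A.add.m_assoc A.l_neg)
  then show ?thesis using cohomology_class_shift[OF assms(1) u(1)] u(2) by metis
qed

text \<open>Scalar action and induced maps on cohomology are defined as unions over all representatives; such a
union collapses to its value at one representative as soon as adding a coboundary changes nothing.\<close>

lemma union_over_cohomology_class:
  assumes "x \<in> carrier A" and "\<And>u. u \<in> carrier A \<Longrightarrow> F (differential A u \<oplus>\<^bsub>A\<^esub> x) = F x"
  shows "(\<Union>y\<in>cohomology_class A x. F y) = F x"
proof -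
  have "F y = F x" if "y \<in> cohomology_class A x" for y
    using that assms(2) unfolding mem_cohomology_class by (elim bexE) simp
  then have "(\<Union>y\<in>cohomology_class A x. F y) = (\<Union>y\<in>cohomology_class A x. F x)" by (rule SUP_cong[OF refl])
  also have "\<dots> = F x" using cohomology_class_self[OF assms(1)] by (intro cSUP_const) blast
  finally show ?thesis .
qed

lemma cohomology_carrier: "carrier (cohomology A) = cohomology_class A ` cocycles A"
  by (simp add: cohomology_def Let_def FactRing_def A_RCOSETS_def' a_r_coset_carrier_update UNION_singleton_eq_range)

lemma cohomology_component:
  "component (cohomology A) i = cohomology_class A ` (cocycles A \<inter> component A i)"
  by (simp add: cohomology_def Let_def)

lemma cohomology_one: "\<one>\<^bsub>cohomology A\<^esub> = cohomology_class A \<one>\<^bsub>A\<^esub>"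
  by (simp add: cohomology_def Let_def FactRing_def a_r_coset_carrier_update)

lemma cohomology_mult:
  assumes "x \<in> cocycles A" and "y \<in> cocycles A"
  shows "cohomology_class A x \<otimes>\<^bsub>cohomology A\<^esub> cohomology_class A y = cohomology_class A (x \<otimes>\<^bsub>A\<^esub> y)"
  using ideal.rcoset_mult_add[OF coboundaries_ideal, of x y] assms
  by (simp add: cohomology_def Let_def FactRing_def a_r_coset_carrier_update)

lemma cohomology_add:
  assumes "x \<in> cocycles A" and "y \<in> cocycles A"
  shows "cohomology_class A x \<oplus>\<^bsub>cohomology A\<^esub> cohomology_class A y = cohomology_class A (x \<oplus>\<^bsub>A\<^esub> y)"
  using ideal.a_rcos_sum[OF coboundaries_ideal, of x y] assms
  by (simp add: cohomology_def Let_def FactRing_def a_r_coset_carrier_update)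

lemma cohomology_smult:
  assumes "c \<in> carrier K" and "x \<in> cocycles A"
  shows "c \<odot>\<^bsub>cohomology A\<^esub> cohomology_class A x = cohomology_class A (c \<odot>\<^bsub>A\<^esub> x)"
proof -
  have x: "x \<in> carrier A" using assms(2) by (simp add: cocycles_def)
  have "cohomology_class A (c \<odot>\<^bsub>A\<^esub> (differential A u \<oplus>\<^bsub>A\<^esub> x)) = cohomology_class A (c \<odot>\<^bsub>A\<^esub> x)"
    if u: "u \<in> carrier A" for u
    using cohomology_class_shift[of "c \<odot>\<^bsub>A\<^esub> x" "c \<odot>\<^bsub>A\<^esub> u"] u x assms(1)
    by (simp add: smult_r_distr differential_closed differential_smult)
  then show ?thesis
    using union_over_cohomology_class[OF x, of "\<lambda>y. cohomology_class A (c \<odot>\<^bsub>A\<^esub> y)"]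
    by (simp add: cohomology_def Let_def)
qed

lemma dg_hom_cocycle:
  assumes "f \<in> dg_algebra_hom K A A" and "x \<in> cocycles A"
  shows "f x \<in> cocycles A"
proof -
  have f: "f \<in> graded_algebra_hom K A A" using assms(1) by (simp add: dg_algebra_hom_def)
  have x: "x \<in> carrier A" "differential A x = \<zero>\<^bsub>A\<^esub>" using assms(2) by (simp_all add: cocycles_def)
  have "differential A (f x) = f (differential A x)" using assms(1) x(1) by (simp add: dg_algebra_hom_def)
  then show ?thesis
    using x graded_hom_simps(1,6)[OF f] by (simp add: cocycles_def)
qed

lemma cohomology_map_class:
  assumes f: "f \<in> dg_algebra_hom K A A" and x: "x \<in> cocycles A"
  shows "cohomology_map A A f (cohomology_class A x) = cohomology_class A (f x)"
proof -
  have h: "f \<in> graded_algebra_hom K A A" and d: "\<And>x. x \<in> carrier A \<Longrightarrow> f (differential A x) = differential A (f x)"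
    using f by (simp_all add: dg_algebra_hom_def)
  have xc: "x \<in> carrier A" using x by (simp add: cocycles_def)
  have "cohomology_class A (f (differential A u \<oplus>\<^bsub>A\<^esub> x)) = cohomology_class A (f x)"
    if u: "u \<in> carrier A" for u
    using cohomology_class_shift[of "f x" "f u"] u xc graded_hom_simps[OF h] d
    by (simp add: differential_closed)
  then show ?thesis
    using union_over_cohomology_class[OF xc, of "\<lambda>y. cohomology_class A (f y)"] x
    by (simp add: cohomology_map_def cohomology_carrier)
qed

lemma cohomology_map_graded_hom:
  assumes f: "f \<in> dg_algebra_hom K A A"
  shows "cohomology_map A A f \<in> graded_algebra_hom K (cohomology A) (cohomology A)"
proof -
  have h: "f \<in> graded_algebra_hom K A A" using f by (simp add: dg_algebra_hom_def)
  have c: "x \<in> carrier A" if "x \<in> cocycles A" for x using that by (simp add: cocycles_def)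
  note push = cohomology_map_class[OF f] dg_hom_cocycle[OF f]
    cohomology_mult cohomology_add cohomology_smult
    cocycles_mult_closed submoduleE(4,5)[OF cocycles_submodule]
  have rep: "\<exists>x. x \<in> cocycles A \<and> x \<in> carrier A \<and> X = cohomology_class A x"
    if "X \<in> carrier (cohomology A)" for X
    using that c unfolding cohomology_carrier by blast
  show ?thesis
    unfolding graded_algebra_hom_def
  proof (intro CollectI conjI ring_hom_memI ballI allI)
    fix X assume "X \<in> carrier (cohomology A)"
    then obtain x where x: "x \<in> cocycles A" "x \<in> carrier A" "X = cohomology_class A x" using rep by blast
    then show "cohomology_map A A f X \<in> carrier (cohomology A)"
      unfolding cohomology_carrier by (simp add: push)
    show "cohomology_map A A f (c \<odot>\<^bsub>cohomology A\<^esub> X) = c \<odot>\<^bsub>cohomology A\<^esub> cohomology_map A A f X"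
      if "c \<in> carrier K" for c
      using x that by (simp add: push graded_hom_simps(4)[OF h])
    fix Y assume "Y \<in> carrier (cohomology A)"
    then obtain y where y: "y \<in> cocycles A" "y \<in> carrier A" "Y = cohomology_class A y" using rep by blast
    show "cohomology_map A A f (X \<otimes>\<^bsub>cohomology A\<^esub> Y) =
        cohomology_map A A f X \<otimes>\<^bsub>cohomology A\<^esub> cohomology_map A A f Y"
      using x y by (simp add: push graded_hom_simps(3)[OF h])
    show "cohomology_map A A f (X \<oplus>\<^bsub>cohomology A\<^esub> Y) =
        cohomology_map A A f X \<oplus>\<^bsub>cohomology A\<^esub> cohomology_map A A f Y"
      using x y by (simp add: push graded_hom_simps(2)[OF h])
  next
    show "cohomology_map A A f \<one>\<^bsub>cohomology A\<^esub> = \<one>\<^bsub>cohomology A\<^esub>"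
      by (simp add: cohomology_one cohomology_map_class[OF f one_cocycle] graded_hom_simps(5)[OF h])
  next
    fix i X assume "X \<in> component (cohomology A) i"
    then obtain x where "x \<in> cocycles A" "x \<in> component A i" "X = cohomology_class A x"
      unfolding cohomology_component by blast
    then show "cohomology_map A A f X \<in> component (cohomology A) i"
      unfolding cohomology_component by (simp add: push graded_hom_simps(7)[OF h])
  qed
qed

lemma cohomology_map_id:
  "cohomology_map A A (\<lambda>x\<in>carrier A. x) = (\<lambda>X\<in>carrier (cohomology A). X)"
proof (rule extensionalityI)
  have id: "(\<lambda>x\<in>carrier A. x) \<in> dg_algebra_hom K A A"
    by (auto simp: dg_algebra_hom_def graded_algebra_hom_def differential_closed component_carrier
        intro!: ring_hom_memI)
  show "cohomology_map A A (\<lambda>x\<in>carrier A. x) X = (\<lambda>X\<in>carrier (cohomology A). X) X"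
    if "X \<in> carrier (cohomology A)" for X
    using that cohomology_map_class[OF id] by (auto simp: cohomology_carrier cocycles_def)
qed (auto simp: cohomology_map_def)

lemma cohomology_map_compose:
  assumes f: "f \<in> dg_algebra_hom K A A" and g: "g \<in> dg_algebra_hom K A A"
    and fg: "compose (carrier A) f g \<in> dg_algebra_hom K A A"
  shows "cohomology_map A A (compose (carrier A) f g) =
    compose (carrier (cohomology A)) (cohomology_map A A f) (cohomology_map A A g)"
proof (rule extensionalityI)
  show "cohomology_map A A (compose (carrier A) f g) X =
      compose (carrier (cohomology A)) (cohomology_map A A f) (cohomology_map A A g) X"
    if X: "X \<in> carrier (cohomology A)" for X
  proof -
    obtain x where x: "x \<in> cocycles A" "X = cohomology_class A x"
      using X unfolding cohomology_carrier by blast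
    then have "x \<in> carrier A" by (simp add: cocycles_def)
    then show ?thesis
      using x X cohomology_map_class[OF f] cohomology_map_class[OF g] cohomology_map_class[OF fg]
        dg_hom_cocycle[OF g] by (simp add: compose_eq)
  qed
qed (auto simp: cohomology_map_def)

end

section \<open>Finite groups of DG automorphisms\<close>

text \<open>\<open>Aut_gr\<close> is a group of bijections with its carrier cut down to the graded maps. Inverses in the
smaller structure agree with those of the ambient group as long as they stay in \<open>H\<close>, so subgroups
of bijections can be transferred for an arbitrary intermediate set \<open>S\<close>.\<close>

lemma (in group) subgroup_carrier_update:
  assumes H: "subgroup H G" and "H \<subseteq> S" and S: "S \<subseteq> carrier G"
  shows "subgroup H (G\<lparr>carrier := S\<rparr>)"
proof
  interpret H: subgroup H G by (rule H)
  show "inv\<^bsub>G\<lparr>carrier := S\<rparr>\<^esub> x \<in> H" if x: "x \<in> H" for x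
  proof -
    have "inv\<^bsub>G\<lparr>carrier := S\<rparr>\<^esub> x = inv x"
      unfolding m_inv_def[of "G\<lparr>carrier := S\<rparr>"]
    proof (rule the_equality)
      show "inv x \<in> carrier (G\<lparr>carrier := S\<rparr>) \<and>
          x \<otimes>\<^bsub>G\<lparr>carrier := S\<rparr>\<^esub> inv x = \<one>\<^bsub>G\<lparr>carrier := S\<rparr>\<^esub> \<and>
          inv x \<otimes>\<^bsub>G\<lparr>carrier := S\<rparr>\<^esub> x = \<one>\<^bsub>G\<lparr>carrier := S\<rparr>\<^esub>"
        using x assms(2) H.mem_carrier by auto
    next
      fix y
      assume "y \<in> carrier (G\<lparr>carrier := S\<rparr>) \<and>
          x \<otimes>\<^bsub>G\<lparr>carrier := S\<rparr>\<^esub> y = \<one>\<^bsub>G\<lparr>carrier := S\<rparr>\<^esub> \<and>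
          y \<otimes>\<^bsub>G\<lparr>carrier := S\<rparr>\<^esub> x = \<one>\<^bsub>G\<lparr>carrier := S\<rparr>\<^esub>"
      then have "y \<in> carrier G" "y \<otimes> x = \<one>" using S by auto
      then show "y = inv x" using x H.mem_carrier inv_equality by metis
    qed
    then show ?thesis using x by simp
  qed
qed (use assms(2) subgroup.m_closed[OF H] subgroup.one_closed[OF H] in auto)

locale finite_dg_action = cochain_dg_algebra K A
  for K :: "('a, 'c) ring_scheme" (structure)
    and A :: "('a, 'b, 'm) dg_algebra_scheme" (structure) +
  fixes G :: "('b \<Rightarrow> 'b) set"
  assumes subgroup_Aut_dg: "subgroup G (Aut_dg K A)"
    and finite_action: "finite G"
begin

lemma action_dg_hom: "g \<in> G \<Longrightarrow> g \<in> dg_algebra_hom K A A"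
  using subgroup.subset[OF subgroup_Aut_dg] by (auto simp: Aut_dg_def)

lemma action_Bij: "g \<in> G \<Longrightarrow> g \<in> Bij (carrier A)"
  using subgroup.subset[OF subgroup_Aut_dg] by (auto simp: Aut_dg_def)

lemma action_graded_hom: "g \<in> G \<Longrightarrow> g \<in> graded_algebra_hom K A A"
  using action_dg_hom by (simp add: dg_algebra_hom_def)

lemmas action_simps = graded_hom_simps[OF action_graded_hom]

lemma action_differential:
  "\<lbrakk>g \<in> G; x \<in> carrier A\<rbrakk> \<Longrightarrow> g (differential A x) = differential A (g x)"
  using action_dg_hom by (simp add: dg_algebra_hom_def)

lemma action_compose: "\<lbrakk>g \<in> G; h \<in> G\<rbrakk> \<Longrightarrow> compose (carrier A) g h \<in> G"
  using subgroup.m_closed[OF subgroup_Aut_dg, of g h] action_Bij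
  by (simp add: Aut_dg_def BijGroup_def)

lemma action_id: "(\<lambda>x\<in>carrier A. x) \<in> G"
  using subgroup.one_closed[OF subgroup_Aut_dg] by (simp add: Aut_dg_def BijGroup_def)

text \<open>Injective because \<open>h\<close> is, surjective because \<open>G\<close> is finite. Besides reindexing sums over \<open>G\<close>, this
produces inverses in \<open>G\<close> that are true inverse maps.\<close>

lemma action_left_translation:
  assumes h: "h \<in> G"
  shows "bij_betw (compose (carrier A) h) G G"
proof -
  have "inj_on (compose (carrier A) h) G"
  proof (rule inj_onI)
    fix g g' assume g: "g \<in> G" "g' \<in> G" and eq: "compose (carrier A) h g = compose (carrier A) h g'"
    have inj: "inj_on h (carrier A)" using action_Bij[OF h] by (simp add: Bij_def bij_betw_def)
    have "g x = g' x" if x: "x \<in> carrier A" for x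
      using inj_onD[OF inj, of "g x" "g' x"] fun_cong[OF eq, of x] x g action_simps(1)
      by (simp add: compose_eq)
    then show "g = g'"
      using extensionalityI[of g "carrier A" g'] g action_Bij Bij_imp_extensional by blast
  qed
  then show ?thesis
    using endo_inj_surj[OF finite_action] action_compose[OF h] by (auto simp: bij_betw_def)
qed

lemma action_left_inverse:
  assumes h: "h \<in> G"
  shows "\<exists>g\<in>G. compose (carrier A) g h = (\<lambda>x\<in>carrier A. x)"
proof -
  obtain g where g: "g \<in> G" "compose (carrier A) h g = (\<lambda>x\<in>carrier A. x)"
    using bij_betw_imp_surj_on[OF action_left_translation[OF h]] action_id by (metis imageE)
  have inj: "inj_on h (carrier A)" using action_Bij[OF h] by (simp add: Bij_def bij_betw_def)
  have "g (h x) = x" if x: "x \<in> carrier A" for x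
  proof (rule inj_onD[OF inj])
    show "h (g (h x)) = h x"
      using fun_cong[OF g(2), of "h x"] x action_simps(1)[OF h] by (simp add: compose_eq)
  qed (use x g h action_simps(1) in auto)
  then have "compose (carrier A) g h = (\<lambda>x\<in>carrier A. x)"
    by (simp add: compose_def fun_eq_iff)
  then show ?thesis using g(1) by blast
qed

lemma fixed_pointsI:
  "\<lbrakk>x \<in> carrier A; \<And>g. g \<in> G \<Longrightarrow> g x = x\<rbrakk> \<Longrightarrow> x \<in> fixed_points A G"
  by (simp add: fixed_points_def)

lemma fixed_points_carrier: "x \<in> fixed_points A G \<Longrightarrow> x \<in> carrier A"
  by (simp add: fixed_points_def)

lemma fixed_points_apply: "\<lbrakk>x \<in> fixed_points A G; g \<in> G\<rbrakk> \<Longrightarrow> g x = x"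
  by (simp add: fixed_points_def)

lemma fixed_points_submodule: "submodule (fixed_points A G) K A"
proof (rule submoduleI_without_inverses)
  show "x \<oplus>\<^bsub>A\<^esub> y \<in> fixed_points A G" if "x \<in> fixed_points A G" "y \<in> fixed_points A G" for x y
    using that fixed_points_carrier by (intro fixed_pointsI) (simp_all add: action_simps fixed_points_apply)
  show "c \<odot>\<^bsub>A\<^esub> x \<in> fixed_points A G" if "c \<in> carrier K" "x \<in> fixed_points A G" for c x
    using that fixed_points_carrier by (intro fixed_pointsI) (simp_all add: action_simps fixed_points_apply)
  show "\<zero>\<^bsub>A\<^esub> \<in> fixed_points A G" by (rule fixed_pointsI) (simp_all add: action_simps)
qed (use fixed_points_carrier in blast)

lemma fixed_points_one: "\<one>\<^bsub>A\<^esub> \<in> fixed_points A G"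
  by (rule fixed_pointsI) (simp_all add: action_simps)

lemma fixed_points_dg_subalgebra: "dg_subalgebra K A (fixed_points A G)"
  unfolding dg_subalgebra_def
proof (intro conjI ballI)
  note sub = submoduleE[OF fixed_points_submodule]
  show "submodule (fixed_points A G) K A" by (rule fixed_points_submodule)
  show "subring (fixed_points A G) A"
  proof (rule A.subringI[OF sub(1) fixed_points_one sub(3) _ sub(5)])
    show "x \<otimes>\<^bsub>A\<^esub> y \<in> fixed_points A G" if "x \<in> fixed_points A G" "y \<in> fixed_points A G" for x y
      using that fixed_points_carrier by (intro fixed_pointsI) (simp_all add: action_simps fixed_points_apply)
  qed
  show "differential A x \<in> fixed_points A G" if "x \<in> fixed_points A G" for x
    using that fixed_points_carrier
    by (intro fixed_pointsI) (simp_all add: differential_closed action_differential fixed_points_apply)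
  show "\<exists>f. homogeneous_decomposition A f x \<and> (\<forall>i. f i \<in> fixed_points A G)"
    if x: "x \<in> fixed_points A G" for x
  proof -
    obtain f where f: "homogeneous_decomposition A f x"
      using direct_sum[OF fixed_points_carrier[OF x]] by blast
    have "f i \<in> fixed_points A G" for i
    proof (rule fixed_pointsI)
      show "f i \<in> carrier A" using f by (rule homogeneous_decompositionE)
      show "g (f i) = f i" if g: "g \<in> G" for g
        by (rule graded_hom_fixes_components[OF action_graded_hom[OF g] f fixed_points_apply[OF x g]])
    qed
    then show ?thesis using f by blast
  qed
qed

lemma fixed_subalgebra_cochain: "cochain_dg_algebra K (fixed_subalgebra A G)"
  unfolding fixed_subalgebra_def
  by (rule cochain_dg_algebra_restrict[OF fixed_points_dg_subalgebra])

text \<open>By functoriality the inverse of an induced map is induced by an inverse in \<open>G\<close>; this gives both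
bijectivity of the induced maps and closure of their set under inverses.\<close>

lemma cohomology_action_subgroup:
  "subgroup (cohomology_map A A ` G) (Aut_gr K (cohomology A))"
proof -
  let ?H = "carrier (cohomology A)" and ?HG = "cohomology_map A A ` G"
  have compose: "compose ?H (cohomology_map A A g) (cohomology_map A A h) =
      cohomology_map A A (compose (carrier A) g h)" if "g \<in> G" "h \<in> G" for g h
    using cohomology_map_compose[OF action_dg_hom action_dg_hom action_dg_hom[OF action_compose]] that by simp
  have closed: "cohomology_map A A g X \<in> ?H" if "g \<in> G" "X \<in> ?H" for g X
    using cohomology_map_graded_hom[OF action_dg_hom[OF that(1)]] that(2)
    unfolding graded_algebra_hom_def by (elim CollectE conjE) (rule ring_hom_closed)
  have retraction: "\<exists>k\<in>G. compose ?H (cohomology_map A A k) (cohomology_map A A g) = (\<lambda>X\<in>?H. X)"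
    if g: "g \<in> G" for g
  proof -
    obtain k where k: "k \<in> G" "compose (carrier A) k g = (\<lambda>x\<in>carrier A. x)"
      using action_left_inverse[OF g] by blast
    show ?thesis
      by (rule bexI[OF _ k(1)]) (simp only: compose[OF k(1) g] k(2) cohomology_map_id)
  qed
  have Bij: "cohomology_map A A g \<in> Bij ?H" if g: "g \<in> G" for g
  proof -
    obtain k where k: "k \<in> G" "compose ?H (cohomology_map A A k) (cohomology_map A A g) = (\<lambda>X\<in>?H. X)"
      using retraction[OF g] by blast
    obtain l where l: "l \<in> G" "compose ?H (cohomology_map A A l) (cohomology_map A A k) = (\<lambda>X\<in>?H. X)"
      using retraction[OF k(1)] by blast
    have kg: "cohomology_map A A k (cohomology_map A A g X) = X" if "X \<in> ?H" for X
      using fun_cong[OF k(2), of X] that by (simp add: compose_eq)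
    have lk: "cohomology_map A A l (cohomology_map A A k X) = X" if "X \<in> ?H" for X
      using fun_cong[OF l(2), of X] that by (simp add: compose_eq)
    \<comment> \<open>A left inverse \<open>k\<close> of \<open>g\<close> that itself has a left inverse \<open>l\<close> is also a right inverse.\<close>
    have gk: "cohomology_map A A g (cohomology_map A A k X) = X" if X: "X \<in> ?H" for X
      using lk[OF closed[OF g closed[OF k(1) X]]] kg[OF closed[OF k(1) X]] lk[OF X] by simp
    have "bij_betw (cohomology_map A A g) ?H ?H"
      by (rule bij_betwI[of _ _ _ "cohomology_map A A k"]) (use closed g k kg gk in auto)
    then show ?thesis by (simp add: Bij_def cohomology_map_def)
  qed
  interpret B: group "BijGroup ?H" by (rule group_BijGroup)
  have "subgroup ?HG (BijGroup ?H)"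
  proof (rule B.subgroupI)
    show "?HG \<subseteq> carrier (BijGroup ?H)" using Bij by (auto simp: BijGroup_def)
    show "?HG \<noteq> {}" using action_id by blast
    show "a \<otimes>\<^bsub>BijGroup ?H\<^esub> b \<in> ?HG" if ab: "a \<in> ?HG" "b \<in> ?HG" for a b
    proof -
      obtain g h where "g \<in> G" "h \<in> G" "a = cohomology_map A A g" "b = cohomology_map A A h"
        using ab by blast
      then show ?thesis
        using Bij compose action_compose by (simp add: BijGroup_def)
    qed
    show "inv\<^bsub>BijGroup ?H\<^esub> a \<in> ?HG" if a: "a \<in> ?HG" for a
    proof -
      obtain g where g: "g \<in> G" "a = cohomology_map A A g" using a by blast
      obtain k where k: "k \<in> G" "compose ?H (cohomology_map A A k) (cohomology_map A A g) = (\<lambda>X\<in>?H. X)"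
        using retraction[OF g(1)] by blast
      have "inv\<^bsub>BijGroup ?H\<^esub> a = cohomology_map A A k"
        by (rule B.inv_equality) (use g k Bij in \<open>simp_all add: BijGroup_def\<close>)
      then show ?thesis using k(1) by blast
    qed
  qed
  then show ?thesis
    unfolding Aut_gr_def
    by (rule B.subgroup_carrier_update)
      (use Bij cohomology_map_graded_hom action_dg_hom in \<open>auto simp: BijGroup_def\<close>)
qed

end

section \<open>Averaging over the group\<close>

lemma (in graded_algebra) finsum_const_smult:
  assumes w: "w \<in> carrier A"
  shows "(\<Oplus>\<^bsub>A\<^esub>i\<in>I. w) = ([card I] \<cdot>\<^bsub>K\<^esub> \<one>\<^bsub>K\<^esub>) \<odot>\<^bsub>A\<^esub> w"
proof (induction I rule: infinite_finite_induct)
  case (insert i I)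
  then show ?case
    using w by (simp add: smult_l_distr A.add.m_comm)
qed (use w in simp_all)

text \<open>The nonmodular case of invariant theory: the characteristic of \<open>K\<close> does not divide the order of
\<open>G\<close>.\<close>

locale nonmodular_finite_dg_action = finite_dg_action K A G
  for K :: "('a, 'c) ring_scheme" (structure)
    and A :: "('a, 'b, 'm) dg_algebra_scheme" (structure)
    and G :: "('b \<Rightarrow> 'b) set" +
  assumes order_nonzero: "[card G] \<cdot>\<^bsub>K\<^esub> \<one>\<^bsub>K\<^esub> \<noteq> \<zero>\<^bsub>K\<^esub>"
begin

definition inverse_order :: 'a
  where "inverse_order = inv\<^bsub>K\<^esub> ([card G] \<cdot>\<^bsub>K\<^esub> \<one>\<^bsub>K\<^esub>)"

text \<open>The Reynolds operator of the action.\<close>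

definition average :: "'b \<Rightarrow> 'b"
  where "average z = inverse_order \<odot>\<^bsub>A\<^esub> (\<Oplus>\<^bsub>A\<^esub>g\<in>G. g z)"

lemma inverse_order:
  "inverse_order \<in> carrier K" "inverse_order \<otimes>\<^bsub>K\<^esub> ([card G] \<cdot>\<^bsub>K\<^esub> \<one>\<^bsub>K\<^esub>) = \<one>\<^bsub>K\<^esub>"
proof -
  have "[card G] \<cdot>\<^bsub>K\<^esub> \<one>\<^bsub>K\<^esub> \<in> Units K"
    using order_nonzero K.field_Units by simp
  then show "inverse_order \<in> carrier K" "inverse_order \<otimes>\<^bsub>K\<^esub> ([card G] \<cdot>\<^bsub>K\<^esub> \<one>\<^bsub>K\<^esub>) = \<one>\<^bsub>K\<^esub>"
    unfolding inverse_order_def by simp_all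
qed

lemma average_const:
  assumes "w \<in> carrier A"
  shows "inverse_order \<odot>\<^bsub>A\<^esub> (\<Oplus>\<^bsub>A\<^esub>g\<in>G. w) = w"
  using assms inverse_order by (simp add: finsum_const_smult flip: smult_assoc1)

lemma average_in_submodule:
  assumes "submodule S K A" and "\<And>g. g \<in> G \<Longrightarrow> g z \<in> S"
  shows "average z \<in> S"
proof -
  have "(\<Oplus>\<^bsub>A\<^esub>g\<in>G. g z) \<in> S" by (rule finsum_in_submodule) (use assms in auto)
  then show ?thesis
    unfolding average_def by (rule submoduleE(4)[OF assms(1) inverse_order(1)])
qed

lemma average_closed: "z \<in> carrier A \<Longrightarrow> average z \<in> carrier A"
  using average_in_submodule[OF carrier_submodule, of z] action_simps(1) by simp

lemma average_fixed:
  assumes z: "z \<in> fixed_points A G"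
  shows "average z = z"
proof -
  have zc: "z \<in> carrier A" by (rule fixed_points_carrier[OF z])
  have "(\<Oplus>\<^bsub>A\<^esub>g\<in>G. g z) = (\<Oplus>\<^bsub>A\<^esub>g\<in>G. z)"
    by (rule A.finsum_cong) (simp_all add: zc fixed_points_apply[OF z] simp_implies_def)
  then show ?thesis using average_const[OF zc] by (simp add: average_def)
qed

text \<open>Applying \<open>h\<close> to the sum over \<open>G\<close> permutes its terms by left translation.\<close>

lemma average_in_fixed_points:
  assumes z: "z \<in> carrier A"
  shows "average z \<in> fixed_points A G"
proof (rule fixed_pointsI)
  show "average z \<in> carrier A" by (rule average_closed[OF z])
  fix h assume h: "h \<in> G"
  have gz: "(\<lambda>g. g z) \<in> G \<rightarrow> carrier A" using action_simps(1)[OF _ z] by blast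
  have sum: "(\<Oplus>\<^bsub>A\<^esub>g\<in>G. g z) \<in> carrier A" using gz by simp
  have "h (\<Oplus>\<^bsub>A\<^esub>g\<in>G. g z) = (\<Oplus>\<^bsub>A\<^esub>g\<in>G. h (g z))"
    by (rule A.additive_finsum) (use action_simps(1,2)[OF h] gz in auto)
  also have "\<dots> = (\<Oplus>\<^bsub>A\<^esub>g\<in>G. compose (carrier A) h g z)"
    using z by (simp add: compose_eq)
  also have "\<dots> = (\<Oplus>\<^bsub>A\<^esub>g\<in>compose (carrier A) h ` G. g z)"
    by (rule A.finsum_reindex[symmetric])
      (use action_left_translation[OF h] gz in \<open>simp_all add: bij_betw_def\<close>)
  also have "\<dots> = (\<Oplus>\<^bsub>A\<^esub>g\<in>G. g z)"
    using action_left_translation[OF h] by (simp add: bij_betw_def)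
  finally show "h (average z) = average z"
    unfolding average_def by (simp add: action_simps(4)[OF h inverse_order(1) sum])
qed

lemma average_differential:
  assumes z: "z \<in> carrier A"
  shows "average (differential A z) = differential A (average z)"
proof -
  have gz: "(\<lambda>g. g z) \<in> G \<rightarrow> carrier A" using action_simps(1)[OF _ z] by blast
  have "differential A (\<Oplus>\<^bsub>A\<^esub>g\<in>G. g z) = (\<Oplus>\<^bsub>A\<^esub>g\<in>G. differential A (g z))"
    by (rule A.additive_finsum) (use differential_closed differential_add gz in auto)
  also have "\<dots> = (\<Oplus>\<^bsub>A\<^esub>g\<in>G. g (differential A z))"
    by (rule A.finsum_cong)
      (use action_differential[OF _ z] gz differential_closed action_simps(1) z in \<open>auto simp: simp_implies_def\<close>)
  finally show ?thesis
    using gz by (simp add: average_def differential_smult inverse_order(1))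
qed

text \<open>If the orbit of \<open>z\<close> stays in the coset \<open>z + S\<close>, then so does its average. With \<open>S\<close> the
coboundaries, averaging preserves each fixed cohomology class.\<close>

lemma average_congruent:
  assumes z: "z \<in> carrier A" and S: "submodule S K A"
    and diff: "\<And>g. g \<in> G \<Longrightarrow> g z \<ominus>\<^bsub>A\<^esub> z \<in> S"
  shows "average z \<ominus>\<^bsub>A\<^esub> z \<in> S"
proof -
  have gz: "g z \<in> carrier A" if "g \<in> G" for g using action_simps(1)[OF that z] .
  let ?D = "\<Oplus>\<^bsub>A\<^esub>g\<in>G. (g z \<ominus>\<^bsub>A\<^esub> z)"
  have D: "?D \<in> S" by (rule finsum_in_submodule[OF S]) (use diff in blast)
  then have Dc: "?D \<in> carrier A" using submoduleE(1)[OF S] by blast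
  have "(\<Oplus>\<^bsub>A\<^esub>g\<in>G. g z) = (\<Oplus>\<^bsub>A\<^esub>g\<in>G. (g z \<ominus>\<^bsub>A\<^esub> z) \<oplus>\<^bsub>A\<^esub> z)"
    by (rule A.finsum_cong)
      (use gz z in \<open>auto simp: simp_implies_def a_minus_def A.add.m_assoc A.l_neg\<close>)
  also have "\<dots> = ?D \<oplus>\<^bsub>A\<^esub> (\<Oplus>\<^bsub>A\<^esub>g\<in>G. z)"
    by (rule A.finsum_addf) (use gz z in auto)
  finally have "average z = inverse_order \<odot>\<^bsub>A\<^esub> ?D \<oplus>\<^bsub>A\<^esub> z"
    unfolding average_def using Dc z by (simp add: smult_r_distr inverse_order(1) average_const)
  then have "average z \<ominus>\<^bsub>A\<^esub> z = inverse_order \<odot>\<^bsub>A\<^esub> ?D"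
    using Dc z inverse_order(1) by (simp add: a_minus_def A.add.m_assoc A.r_neg)
  then show ?thesis using submoduleE(4)[OF S inverse_order(1) D] by simp
qed

lemma cocycles_fixed_subalgebra:
  "cocycles (fixed_subalgebra A G) = cocycles A \<inter> fixed_points A G"
  by (auto simp: cocycles_def fixed_subalgebra_def restrict_algebra_def fixed_points_carrier)

text \<open>The average of a primitive of a fixed element \<open>b\<close> is again a primitive of \<open>b\<close>, since averaging
commutes with the differential and leaves \<open>b\<close> alone. This is what makes the map from the cohomology
of the fixed subalgebra to that of \<open>A\<close> injective.\<close>

lemma coboundaries_fixed_subalgebra:
  "coboundaries (fixed_subalgebra A G) = coboundaries A \<inter> fixed_points A G"
proof (intro equalityI subsetI)
  fix b assume "b \<in> coboundaries (fixed_subalgebra A G)"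
  then obtain u where u: "u \<in> fixed_points A G" "b = differential A u"
    by (auto simp: coboundaries_def fixed_subalgebra_def restrict_algebra_def)
  then show "b \<in> coboundaries A \<inter> fixed_points A G"
    using fixed_points_dg_subalgebra fixed_points_carrier
    by (simp add: dg_subalgebra_def coboundaries_def)
next
  fix b assume b: "b \<in> coboundaries A \<inter> fixed_points A G"
  then obtain u where u: "u \<in> carrier A" "b = differential A u"
    by (auto simp: coboundaries_def)
  have "b = differential A (average u)"
    using average_fixed[of b] average_differential[OF u(1)] u(2) b by simp
  then show "b \<in> coboundaries (fixed_subalgebra A G)"
    using average_in_fixed_points[OF u(1)]
    by (simp add: coboundaries_def fixed_subalgebra_def restrict_algebra_def)
qed

lemma cohomology_class_fixed_subalgebra:
  assumes x: "x \<in> fixed_points A G"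
  shows "cohomology_class (fixed_subalgebra A G) x = cohomology_class A x \<inter> fixed_points A G"
proof -
  have xc: "x \<in> carrier A" by (rule fixed_points_carrier[OF x])
  have F: "b \<oplus>\<^bsub>A\<^esub> x \<in> fixed_points A G \<longleftrightarrow> b \<in> fixed_points A G" if b: "b \<in> carrier A" for b
  proof
    assume "b \<oplus>\<^bsub>A\<^esub> x \<in> fixed_points A G"
    then have "(b \<oplus>\<^bsub>A\<^esub> x) \<oplus>\<^bsub>A\<^esub> \<ominus>\<^bsub>A\<^esub> x \<in> fixed_points A G"
      using x submoduleE(3,5)[OF fixed_points_submodule] by simp
    then show "b \<in> fixed_points A G" using b xc by (simp add: A.add.m_assoc A.r_neg)
  qed (use x submoduleE(5)[OF fixed_points_submodule] in simp)
  have "cohomology_class (fixed_subalgebra A G) x =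
      (\<lambda>b. b \<oplus>\<^bsub>A\<^esub> x) ` (coboundaries A \<inter> fixed_points A G)"
    unfolding a_r_coset_def' coboundaries_fixed_subalgebra
    by (auto simp: fixed_subalgebra_def restrict_algebra_def)
  also have "\<dots> = (\<lambda>b. b \<oplus>\<^bsub>A\<^esub> x) ` coboundaries A \<inter> fixed_points A G"
    using F submoduleE(1)[OF coboundaries_submodule] by blast
  also have "\<dots> = cohomology_class A x \<inter> fixed_points A G"
    unfolding a_r_coset_def' by blast
  finally show ?thesis .
qed

lemma average_of_fixed_class:
  assumes z: "z \<in> cocycles A"
    and fixed: "cohomology_class A z \<in> fixed_points (cohomology A) (cohomology_map A A ` G)"
  shows "average z \<in> cocycles A \<inter> fixed_points A G"
    and "cohomology_class A (average z) = cohomology_class A z"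
proof -
  have zc: "z \<in> carrier A" using z by (simp add: cocycles_def)
  have gz: "g z \<in> cocycles A" if "g \<in> G" for g
    by (rule dg_hom_cocycle[OF action_dg_hom[OF that] z])
  show "average z \<in> cocycles A \<inter> fixed_points A G"
    using average_in_submodule[OF cocycles_submodule gz] average_in_fixed_points[OF zc] by simp
  have "g z \<ominus>\<^bsub>A\<^esub> z \<in> coboundaries A" if g: "g \<in> G" for g
  proof (rule cohomology_class_minus_mem[OF zc action_simps(1)[OF g zc]])
    have "cohomology_map A A g (cohomology_class A z) = cohomology_class A z"
      using fixed g by (simp add: fixed_points_def)
    then show "cohomology_class A (g z) = cohomology_class A z"
      using cohomology_map_class[OF action_dg_hom[OF g] z] by simp
  qed
  then have "average z \<ominus>\<^bsub>A\<^esub> z \<in> coboundaries A"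
    using average_congruent[OF zc coboundaries_submodule] by blast
  then show "cohomology_class A (average z) = cohomology_class A z"
    by (intro cohomology_class_eqI zc average_closed)
qed

lemma class_in_fixed_points:
  assumes x: "x \<in> cocycles A \<inter> fixed_points A G"
  shows "cohomology_class A x \<in> fixed_points (cohomology A) (cohomology_map A A ` G)"
proof -
  have "cohomology_map A A g (cohomology_class A x) = cohomology_class A x" if g: "g \<in> G" for g
    using cohomology_map_class[OF action_dg_hom[OF g], of x] fixed_points_apply[of x g] x g by simp
  moreover have "cohomology_class A x \<in> carrier (cohomology A)"
    using x by (simp add: cohomology_carrier)
  ultimately show ?thesis by (simp add: fixed_points_def)
qed

text \<open>Averaging replaces a representative of a fixed class by a fixed one; this is the surjectivity half
of the isomorphism.\<close>

lemma fixed_cohomology_representatives: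
  "fixed_points (cohomology A) (cohomology_map A A ` G) =
    cohomology_class A ` (cocycles A \<inter> fixed_points A G)"
proof (intro equalityI subsetI)
  fix X assume X: "X \<in> fixed_points (cohomology A) (cohomology_map A A ` G)"
  then have "X \<in> carrier (cohomology A)" by (simp add: fixed_points_def)
  then obtain z where z: "z \<in> cocycles A" "X = cohomology_class A z"
    unfolding cohomology_carrier by blast
  show "X \<in> cohomology_class A ` (cocycles A \<inter> fixed_points A G)"
    by (rule image_eqI[of _ _ "average z"]) (use average_of_fixed_class[OF z(1)] X z(2) in simp_all)
qed (use class_in_fixed_points in blast)

lemma fixed_cohomology_component_representatives:
  assumes X: "X \<in> fixed_points (cohomology A) (cohomology_map A A ` G)"
    and "X \<in> component (cohomology A) i"
  shows "\<exists>x \<in> cocycles A \<inter> fixed_points A G \<inter> component A i. X = cohomology_class A x"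
proof -
  obtain z where z: "z \<in> cocycles A" "z \<in> component A i" "X = cohomology_class A z"
    using assms(2) unfolding cohomology_component by blast
  have "average z \<in> component A i"
    by (rule average_in_submodule[OF component_submodule action_simps(7)[OF _ z(2)]])
  then show ?thesis
    using average_of_fixed_class[OF z(1)] X z(3) by (intro bexI[of _ "average z"]) simp_all
qed

text \<open>On classes of fixed cocycles the map sends \<open>[x]\<close> in the cohomology of \<open>A\<close> to \<open>[x]\<close> in the
cohomology of the fixed subalgebra, so compatibility with the operations is read off from
representatives. Writing it as an intersection makes it independent of their choice.\<close>

lemma fixed_cohomology_iso:
  "(\<lambda>X. X \<inter> fixed_points A G) \<in> graded_algebra_iso K
    (fixed_subalgebra (cohomology A) (cohomology_map A A ` G)) (cohomology (fixed_subalgebra A G))"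
proof -
  let ?F = "fixed_points A G" and ?AG = "fixed_subalgebra A G"
  let ?H = "fixed_subalgebra (cohomology A) (cohomology_map A A ` G)"
  interpret Fix: cochain_dg_algebra K ?AG by (rule fixed_subalgebra_cochain)
  have AG [simp]: "add ?AG = add A" "mult ?AG = mult A" "one ?AG = one A" "smult ?AG = smult A"
    "component ?AG i = component A i \<inter> ?F" for i
    by (simp_all add: fixed_subalgebra_def restrict_algebra_def)
  have H [simp]: "add ?H = add (cohomology A)" "mult ?H = mult (cohomology A)"
    "one ?H = one (cohomology A)" "smult ?H = smult (cohomology A)"
    and carrier_H: "carrier ?H = cohomology_class A ` (cocycles A \<inter> ?F)"
    and component_H: "component ?H i =
      component (cohomology A) i \<inter> fixed_points (cohomology A) (cohomology_map A A ` G)" for i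
    by (simp_all add: fixed_subalgebra_def restrict_algebra_def fixed_cohomology_representatives)
  have closed: "x \<otimes>\<^bsub>A\<^esub> y \<in> ?F" "x \<oplus>\<^bsub>A\<^esub> y \<in> ?F" "c \<in> carrier K \<Longrightarrow> c \<odot>\<^bsub>A\<^esub> x \<in> ?F"
    if "x \<in> ?F" "y \<in> ?F" for x y c
    using that subringE(6,7)[of ?F A] fixed_points_dg_subalgebra submoduleE(4)[OF fixed_points_submodule]
    by (simp_all add: dg_subalgebra_def)
  have phi: "cohomology_class A x \<inter> ?F = cohomology_class ?AG x" if "x \<in> ?F" for x
    using cohomology_class_fixed_subalgebra[OF that] by simp
  show ?thesis
    unfolding graded_algebra_iso_def graded_algebra_hom_def
  proof (intro CollectI conjI ring_hom_memI ballI allI)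
    fix X assume "X \<in> carrier ?H"
    then obtain x where x: "x \<in> cocycles A" "x \<in> ?F" "X = cohomology_class A x"
      unfolding carrier_H by blast
    have x': "x \<in> cocycles ?AG" using x by (simp add: cocycles_fixed_subalgebra)
    show "X \<inter> ?F \<in> carrier (cohomology ?AG)"
      unfolding x(3) phi[OF x(2)] Fix.cohomology_carrier using x' by (rule imageI)
    show "(c \<odot>\<^bsub>?H\<^esub> X) \<inter> ?F = c \<odot>\<^bsub>cohomology ?AG\<^esub> (X \<inter> ?F)" if c: "c \<in> carrier K" for c
      using x c Fix.cohomology_smult[OF c x'] closed(3)[OF x(2) x(2) c]
      by (simp add: cohomology_smult phi)
    fix Y assume "Y \<in> carrier ?H"
    then obtain y where y: "y \<in> cocycles A" "y \<in> ?F" "Y = cohomology_class A y"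
      unfolding carrier_H by blast
    have y': "y \<in> cocycles ?AG" using y by (simp add: cocycles_fixed_subalgebra)
    show "(X \<otimes>\<^bsub>?H\<^esub> Y) \<inter> ?F = (X \<inter> ?F) \<otimes>\<^bsub>cohomology ?AG\<^esub> (Y \<inter> ?F)"
      using x y Fix.cohomology_mult[OF x' y'] closed(1)[OF x(2) y(2)]
      by (simp add: cohomology_mult phi)
    show "(X \<oplus>\<^bsub>?H\<^esub> Y) \<inter> ?F = (X \<inter> ?F) \<oplus>\<^bsub>cohomology ?AG\<^esub> (Y \<inter> ?F)"
      using x y Fix.cohomology_add[OF x' y'] closed(2)[OF x(2) y(2)]
      by (simp add: cohomology_add phi)
  next
    show "\<one>\<^bsub>?H\<^esub> \<inter> ?F = \<one>\<^bsub>cohomology ?AG\<^esub>"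
      by (simp add: cohomology_one Fix.cohomology_one phi[OF fixed_points_one])
  next
    fix i X assume "X \<in> component ?H i"
    then obtain x where x: "x \<in> cocycles A" "x \<in> ?F" "x \<in> component A i" "X = cohomology_class A x"
      using fixed_cohomology_component_representatives[of X i] unfolding component_H by blast
    show "X \<inter> ?F \<in> component (cohomology ?AG) i"
      unfolding x(4) phi[OF x(2)] Fix.cohomology_component
      using x by (intro imageI) (simp add: cocycles_fixed_subalgebra)
  next
    show "bij_betw (\<lambda>X. X \<inter> ?F) (carrier ?H) (carrier (cohomology ?AG))"
      unfolding bij_betw_def
    proof
      show "inj_on (\<lambda>X. X \<inter> ?F) (carrier ?H)"
      proof (rule inj_onI)
        fix X Y assume XY: "X \<in> carrier ?H" "Y \<in> carrier ?H" "X \<inter> ?F = Y \<inter> ?F"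
        obtain x y where x: "x \<in> ?F" "X = cohomology_class A x" and y: "y \<in> ?F" "Y = cohomology_class A y"
          using XY(1,2) unfolding carrier_H by blast
        \<comment> \<open>The fixed representative \<open>x\<close> lies in the common intersection, hence in both classes.\<close>
        have "x \<in> X \<inter> ?F"
          using x cohomology_class_self[OF fixed_points_carrier[OF x(1)]] by simp
        then have "x \<in> cohomology_class A y" using XY(3) y(2) by simp
        then show "X = Y"
          using cohomology_class_eq[OF fixed_points_carrier[OF y(1)]] x(2) y(2) by simp
      qed
      show "(\<lambda>X. X \<inter> ?F) ` carrier ?H = carrier (cohomology ?AG)"
        unfolding carrier_H Fix.cohomology_carrier cocycles_fixed_subalgebra image_image
        by (rule image_cong) (simp_all add: phi)
    qed
  qed
qed

end

theorem proposition4p4: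
  fixes K :: "('a, 'c) ring_scheme"
    and A :: "('a, 'b, 'm) dg_algebra_scheme"
    and G :: "('b \<Rightarrow> 'b) set"
  assumes "connected_cochain_dg_algebra K A"
    and "subgroup G (Aut_dg K A)"
    and "finite G"
  defines "HG \<equiv> cohomology_map A A ` G"
  shows "(dg_subalgebra K A (fixed_points A G) \<and>
          connected_cochain_dg_algebra K (fixed_subalgebra A G)) \<and>
         (finite HG \<and> subgroup HG (Aut_gr K (cohomology A))) \<and>
         ([card G] \<cdot>\<^bsub>K\<^esub> \<one>\<^bsub>K\<^esub> \<noteq> \<zero>\<^bsub>K\<^esub> \<longrightarrow>
           (\<exists>\<phi>. \<phi> \<in> graded_algebra_iso K
                  (fixed_subalgebra (cohomology A) HG)
                  (cohomology (fixed_subalgebra A G))))"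
proof -
  interpret connected_cochain_dg_algebra K A by (rule assms(1))
  interpret finite_dg_action K A G
    by (intro finite_dg_action.intro finite_dg_action_axioms.intro cochain_dg_algebra_axioms assms)
  have connected: "connected_cochain_dg_algebra K (fixed_subalgebra A G)"
  proof (intro connected_cochain_dg_algebra.intro connected_cochain_dg_algebra_axioms.intro)
    show "cochain_dg_algebra K (fixed_subalgebra A G)" by (rule fixed_subalgebra_cochain)
    have "component A 0 \<subseteq> fixed_points A G"
      unfolding component_zero using submoduleE(4)[OF fixed_points_submodule] fixed_points_one by blast
    then show "component (fixed_subalgebra A G) 0 =
        (\<lambda>c. c \<odot>\<^bsub>fixed_subalgebra A G\<^esub> \<one>\<^bsub>fixed_subalgebra A G\<^esub>) ` carrier K"
      using component_zero by (auto simp: fixed_subalgebra_def restrict_algebra_def)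
    show "\<one>\<^bsub>fixed_subalgebra A G\<^esub> \<noteq> \<zero>\<^bsub>fixed_subalgebra A G\<^esub>"
      using one_not_zero by (simp add: fixed_subalgebra_def restrict_algebra_def)
  qed
  have iso: "\<exists>\<phi>. \<phi> \<in> graded_algebra_iso K (fixed_subalgebra (cohomology A) HG) (cohomology (fixed_subalgebra A G))"
    if "[card G] \<cdot>\<^bsub>K\<^esub> \<one>\<^bsub>K\<^esub> \<noteq> \<zero>\<^bsub>K\<^esub>"
  proof -
    interpret nonmodular_finite_dg_action K A G
      by (intro nonmodular_finite_dg_action.intro nonmodular_finite_dg_action_axioms.intro
          finite_dg_action_axioms that)
    show ?thesis unfolding HG_def using fixed_cohomology_iso by blast
  qed
  show ?thesis
    using fixed_points_dg_subalgebra connected cohomology_action_subgroup finite_action iso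
    by (simp add: HG_def)
qed

end
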